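(* Let $3\leq n\leq 8$, let $L$ be the del Pezzo lattice of rank $n$, let $R=\{v\in L : v^2=2\}$ be its root system, let $L_2=L/2L$ with its quadratic form $q$ and its bilinear form $(\ |\ )$, and let $\varphi:R\rightarrow L_2$ be the reduction mod. $2$. Then $\varphi$ induces a bijection from $R/\{\pm 1\}$ onto $q^{-1}(1)$ if $n\neq 7$, and onto $q^{-1}(1)\smallsetminus\{k\}$ if $n=7$, where $k$ is the nonzero element of the kernel of $(\ |\ )$ (i.e. of $\{x\in L_2 : (x|y)=0 \text{ for all } y\in L_2\}$).
   Context: Del Pezzo lattices: for $3\leq n\leq 8$, let $L_0$ be the free $\mathbb{Z}$-module with basis $E_0,\ldots,E_n$, endowed with the symmetric bilinear form defined by $E_0^2=-1$, $E_i^2=1$ for $i\geq 1$, and $(E_i\cdot E_j)=0$ for $i\neq j$. Let $K=3E_0-\sum_{i\geq 1}E_i$. The del Pezzo lattice of rank $n$ is $L=K^{\perp}\subset L_0$; it is an even lattice (positive definite, of rank $n$). The vectors of square $2$ in $L$ form a root system $R$, of type $A_1\times A_2, A_4, D_5, E_6, E_7, E_8$ for $n=3,4,5,6,7,8$ respectively. Reduction mod. $2$: $L_2:=L/2L$ is an $\mathbb{F}_2$-vector space; the bilinear form $(\ |\ ):L_2\times L_2\to\mathbb{F}_2$ is deduced from the scalar product on $L$ by reduction mod. $2$, and the quadratic form $q:L_2\to\mathbb{F}_2$ is deduced from $v\mapsto \frac{1}{2}v^2$ on $L$. They satisfy $q(x+y)=q(x)+q(y)+(x|y)$. $R/\{\pm1\}$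 denotes the quotient of $R$ by $\alpha\sim-\alpha$. *)

theory Defs
  imports "HOL-Library.Function_Algebras" "HOL-Library.Z2" "HOL-Algebra.Coset"
begin

text \<open>A vector of the ambient lattice is given by its coordinates
  with respect to \<open>E\<^sub>0, \<dots>, E\<^sub>n\<close>, extended by zero outside \<open>{0..n}\<close>;
  addition and negation are the pointwise ones.\<close>

definition ambient_lattice :: "nat \<Rightarrow> (nat \<Rightarrow> int) set" where
  "ambient_lattice n = {v. \<forall>i>n. v i = 0}"

definition lattice_form :: "nat \<Rightarrow> (nat \<Rightarrow> int) \<Rightarrow> (nat \<Rightarrow> int) \<Rightarrow> int" where
  "lattice_form n v w = - (v 0 * w 0) + (\<Sum>i=1..n. v i * w i)"

definition basis_vec :: "nat \<Rightarrow> nat \<Rightarrow> int" where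
  "basis_vec i = (\<lambda>j. if j = i then 1 else 0)"

definition canonical_vec :: "nat \<Rightarrow> nat \<Rightarrow> int" where
  "canonical_vec n = (\<lambda>j. 3 * basis_vec 0 j - (\<Sum>i=1..n. basis_vec i j))"

definition del_pezzo_lattice :: "nat \<Rightarrow> (nat \<Rightarrow> int) set" where
  "del_pezzo_lattice n = {v \<in> ambient_lattice n. lattice_form n v (canonical_vec n) = 0}"

definition roots :: "nat \<Rightarrow> (nat \<Rightarrow> int) set" where
  "roots n = {v \<in> del_pezzo_lattice n. lattice_form n v v = 2}"

definition antipodal :: "nat \<Rightarrow> ((nat \<Rightarrow> int) \<times> (nat \<Rightarrow> int)) set" where
  "antipodal n = {(a, b). a \<in> roots n \<and> b \<in> roots n \<and> (b = a \<or> b = - a)}"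

text \<open>The additive group \<open>L\<close> in the notation of the group library, so that \<open>L/2L\<close> is a
  factor group: its elements are cosets, and its zero element is \<open>\<one>\<close>.\<close>

definition lattice_group :: "nat \<Rightarrow> (nat \<Rightarrow> int) monoid" where
  "lattice_group n = \<lparr>carrier = del_pezzo_lattice n, monoid.mult = (+), one = 0\<rparr>"

definition double_lattice :: "nat \<Rightarrow> (nat \<Rightarrow> int) set" where
  "double_lattice n = (\<lambda>v. v + v) ` del_pezzo_lattice n"

definition lattice_mod2 :: "nat \<Rightarrow> (nat \<Rightarrow> int) set monoid" where
  "lattice_mod2 n = lattice_group n Mod double_lattice n"

definition reduction :: "nat \<Rightarrow> (nat \<Rightarrow> int) \<Rightarrow> (nat \<Rightarrow> int) set" where
  "reduction n v = double_lattice n #>\<^bsub>lattice_group n\<^esub> v"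

text \<open>The next two functions are defined through arbitrary representatives of the cosets.
  Independence of the representatives is \<open>quad_mod2_reduction\<close> and \<open>bilin_mod2_reduction\<close>
  below; the division by 2 is exact by \<open>even_lattice_form\<close>.\<close>

definition quad_mod2 :: "nat \<Rightarrow> (nat \<Rightarrow> int) set \<Rightarrow> bit" where
  "quad_mod2 n X = the_elem ((\<lambda>v. of_int (lattice_form n v v div 2)) ` X)"

definition bilin_mod2 :: "nat \<Rightarrow> (nat \<Rightarrow> int) set \<Rightarrow> (nat \<Rightarrow> int) set \<Rightarrow> bit" where
  "bilin_mod2 n X Y = the_elem ((\<lambda>(v, w). of_int (lattice_form n v w)) ` (X \<times> Y))"

definition quad_one :: "nat \<Rightarrow> (nat \<Rightarrow> int) set set" where
  "quad_one n = {X \<in> carrier (lattice_mod2 n). quad_mod2 n X = 1}"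

definition bilin_kernel :: "nat \<Rightarrow> (nat \<Rightarrow> int) set set" where
  "bilin_kernel n = {X \<in> carrier (lattice_mod2 n).
     \<forall>Y \<in> carrier (lattice_mod2 n). bilin_mod2 n X Y = 0}"

text \<open>The map induced by \<open>reduction\<close> on classes of roots; it is meaningful because
  \<open>reduction\<close> respects \<open>antipodal\<close>.\<close>

definition induced_reduction :: "nat \<Rightarrow> (nat \<Rightarrow> int) set \<Rightarrow> (nat \<Rightarrow> int) set" where
  "induced_reduction n C = the_elem (reduction n ` C)"

lemma lattice_form_add_left: "lattice_form n (u + v) w = lattice_form n u w + lattice_form n v w"
  by (simp add: lattice_form_def algebra_simps sum.distrib)

lemma lattice_form_commute: "lattice_form n v w = lattice_form n w v"
  by (simp add: lattice_form_def mult.commute)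

lemma lattice_form_add_right: "lattice_form n w (u + v) = lattice_form n w u + lattice_form n w v"
  by (metis lattice_form_add_left lattice_form_commute)

lemma lattice_form_uminus_left: "lattice_form n (- v) w = - lattice_form n v w"
  by (simp add: lattice_form_def sum_negf)

lemma lattice_form_canonical: "lattice_form n v (canonical_vec n) = - 3 * v 0 - (\<Sum>i=1..n. v i)"
proof -
  have "canonical_vec n 0 = 3"
    by (simp add: canonical_vec_def basis_vec_def)
  moreover have "canonical_vec n j = - 1" if "j \<in> {1..n}" for j
    using that by (simp add: canonical_vec_def basis_vec_def)
  ultimately show ?thesis
    by (simp add: lattice_form_def sum_negf)
qed

lemma even_lattice_form:
  assumes "v \<in> del_pezzo_lattice n"
  shows "even (lattice_form n v v)"
proof -
  have "(\<Sum>i=1..n. v i) = - 3 * v 0"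
    using assms by (simp add: del_pezzo_lattice_def lattice_form_canonical)
  moreover have "even ((\<Sum>i=1..n. v i * v i) - (\<Sum>i=1..n. v i))"
    unfolding sum_subtractf [symmetric] by (rule dvd_sum) simp
  ultimately show ?thesis
    by (simp add: lattice_form_def)
qed

lemma del_pezzo_zero: "0 \<in> del_pezzo_lattice n"
  by (simp add: del_pezzo_lattice_def ambient_lattice_def lattice_form_def)

lemma del_pezzo_add:
  "v \<in> del_pezzo_lattice n \<Longrightarrow> w \<in> del_pezzo_lattice n \<Longrightarrow> v + w \<in> del_pezzo_lattice n"
  by (simp add: del_pezzo_lattice_def ambient_lattice_def lattice_form_add_left)

lemma del_pezzo_uminus: "v \<in> del_pezzo_lattice n \<Longrightarrow> - v \<in> del_pezzo_lattice n"
  by (simp add: del_pezzo_lattice_def ambient_lattice_def lattice_form_uminus_left)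

lemma comm_group_lattice_group: "comm_group (lattice_group n)"
proof (rule comm_groupI)
  fix x
  assume "x \<in> carrier (lattice_group n)"
  then show "\<exists>y\<in>carrier (lattice_group n). y \<otimes>\<^bsub>lattice_group n\<^esub> x = \<one>\<^bsub>lattice_group n\<^esub>"
    by (intro bexI [of _ "- x"]) (auto simp: lattice_group_def del_pezzo_uminus)
qed (auto simp: lattice_group_def del_pezzo_zero del_pezzo_add add_ac)

lemma normal_double_lattice: "double_lattice n \<lhd> lattice_group n"
proof -
  interpret comm_group "lattice_group n"
    by (rule comm_group_lattice_group)
  have inv: "inv\<^bsub>lattice_group n\<^esub> x = - x" if "x \<in> del_pezzo_lattice n" for x
    using that by (intro inv_equality) (auto simp: lattice_group_def del_pezzo_uminus)
  have closed: "v + v \<in> del_pezzo_lattice n" if "v \<in> del_pezzo_lattice n" for v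
    using that by (intro del_pezzo_add)
  have "subgroup (double_lattice n) (lattice_group n)"
  proof (rule subgroupI)
    show "double_lattice n \<subseteq> carrier (lattice_group n)"
      using closed by (auto simp: double_lattice_def lattice_group_def)
    show "double_lattice n \<noteq> {}"
      using del_pezzo_zero by (auto simp: double_lattice_def)
    show "inv\<^bsub>lattice_group n\<^esub> a \<in> double_lattice n" if "a \<in> double_lattice n" for a
    proof -
      from that obtain v where v: "v \<in> del_pezzo_lattice n" "a = v + v"
        by (auto simp: double_lattice_def)
      then have "inv\<^bsub>lattice_group n\<^esub> a = - v + - v"
        using inv [OF closed [OF v(1)]] by (simp only: minus_add_distrib)
      then show ?thesis
        unfolding double_lattice_def using del_pezzo_uminus [OF v(1)] by (rule image_eqI)
    qed
    show "a \<otimes>\<^bsub>lattice_group n\<^esub> b \<in> double_lattice n"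
      if a: "a \<in> double_lattice n" and b: "b \<in> double_lattice n" for a b
    proof -
      from a b obtain v w where vw: "v \<in> del_pezzo_lattice n" "w \<in> del_pezzo_lattice n"
        "a = v + v" "b = w + w"
        by (auto simp: double_lattice_def)
      have "a \<otimes>\<^bsub>lattice_group n\<^esub> b = (v + w) + (v + w)"
        by (simp only: lattice_group_def vw monoid.simps add_ac)
      then show ?thesis
        unfolding double_lattice_def using del_pezzo_add [OF vw(1,2)] by (rule image_eqI)
    qed
  qed
  then show ?thesis
    by (rule subgroup_imp_normal)
qed

lemma reduction_eq: "reduction n v = (\<lambda>u. v + (u + u)) ` del_pezzo_lattice n"
  by (auto simp: reduction_def r_coset_def double_lattice_def lattice_group_def add_ac)

lemma reduction_self: "v \<in> reduction n v"
  unfolding reduction_eq using del_pezzo_zero by (auto intro!: image_eqI [of _ _ 0])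

lemma carrier_lattice_mod2: "carrier (lattice_mod2 n) = reduction n ` del_pezzo_lattice n"
  by (auto simp: lattice_mod2_def FactGroup_def RCOSETS_def reduction_def lattice_group_def)

lemma the_elem_image_const:
  assumes "x \<in> X" "\<And>y. y \<in> X \<Longrightarrow> f y = c"
  shows "the_elem (f ` X) = c"
proof -
  have "f ` X = {c}"
    using assms by auto
  then show ?thesis
    by simp
qed

lemma quad_mod2_reduction:
  assumes v: "v \<in> del_pezzo_lattice n"
  shows "quad_mod2 n (reduction n v) = of_int (lattice_form n v v div 2)"
  unfolding quad_mod2_def
proof (rule the_elem_image_const [OF reduction_self])
  fix w assume "w \<in> reduction n v"
  then obtain u where u: "u \<in> del_pezzo_lattice n" "w = v + (u + u)"
    by (auto simp: reduction_eq)
  have "lattice_form n w w = lattice_form n v v + 2 * (2 * (lattice_form n v u + lattice_form n u u))"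
    by (simp only: u(2) lattice_form_add_left lattice_form_add_right lattice_form_commute [of n u v])
      (simp add: algebra_simps)
  then have "lattice_form n w w div 2
      = lattice_form n v v div 2 + 2 * (lattice_form n v u + lattice_form n u u)"
    by simp
  then show "(of_int (lattice_form n w w div 2) :: bit) = of_int (lattice_form n v v div 2)"
    by (simp only: of_int_add of_int_mult) simp
qed

lemma bilin_mod2_reduction:
  "bilin_mod2 n (reduction n v) (reduction n w) = of_int (lattice_form n v w)"
  unfolding bilin_mod2_def
proof (rule the_elem_image_const [of "(v, w)"])
  show "(v, w) \<in> reduction n v \<times> reduction n w"
    by (simp add: reduction_self)
  fix p assume "p \<in> reduction n v \<times> reduction n w"
  then obtain a b where ab: "p = (v + (a + a), w + (b + b))"
    by (auto simp: reduction_eq)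
  have "lattice_form n (v + (a + a)) (w + (b + b))
      = lattice_form n v w + 2 * (lattice_form n v b + lattice_form n a w + 2 * lattice_form n a b)"
    by (simp only: lattice_form_add_left lattice_form_add_right) (simp add: algebra_simps)
  then have "(of_int (lattice_form n (v + (a + a)) (w + (b + b))) :: bit) = of_int (lattice_form n v w)"
    by (simp only: of_int_add of_int_mult) simp
  then show "(case p of (v, w) \<Rightarrow> (of_int (lattice_form n v w) :: bit)) = of_int (lattice_form n v w)"
    by (simp add: ab)
qed

lemma quad_mod2_add:
  assumes "v \<in> del_pezzo_lattice n" "w \<in> del_pezzo_lattice n"
  shows "quad_mod2 n (reduction n (v + w)) = quad_mod2 n (reduction n v)
    + quad_mod2 n (reduction n w) + bilin_mod2 n (reduction n v) (reduction n w)"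
proof -
  obtain a b where ab: "lattice_form n v v = 2 * a" "lattice_form n w w = 2 * b"
    using assms even_lattice_form by (meson evenE)
  then have "lattice_form n (v + w) (v + w) = 2 * (a + b + lattice_form n v w)"
    by (simp add: lattice_form_add_left lattice_form_add_right lattice_form_commute [of n w v])
  with ab show ?thesis
    by (simp only: quad_mod2_reduction assms del_pezzo_add bilin_mod2_reduction) simp
qed

lemma equiv_antipodal: "equiv (roots n) (antipodal n)"
  by (rule equivI) (auto simp: antipodal_def refl_on_def intro!: symI transI)

end

theory Submission
  imports Defs
begin

text \<open>A class in \<open>L/2L\<close> is determined by the set \<open>S \<subseteq> {1..n}\<close> of indices of the odd coordinates of a
  representative \<open>v\<close>. Squares being \<open>0\<close> or \<open>1\<close> mod \<open>4\<close>, \<open>q = 1\<close> forces \<open>|S| mod 4 \<in> {2, 3}\<close>, hence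
  \<open>|S| \<in> {2, 3, 6, 7}\<close>. The roots \<open>E\<^sub>i - E\<^sub>j\<close>, \<open>E\<^sub>0 - E\<^sub>i - E\<^sub>j - E\<^sub>k\<close>, \<open>2E\<^sub>0 - \<Sum>\<^sub>S E\<^sub>i\<close> and, for \<open>n = 8\<close>,
  \<open>3E\<^sub>0 - 2E\<^sub>i - \<Sum>\<^sub>S E\<^sub>j\<close> realise all these sets, except the full set when \<open>n = 7\<close>, which is the
  class \<open>k\<close>. For injectivity, let \<open>a - b = 2u\<close> for roots with \<open>(a|b) \<ge> 0\<close>, as may be assumed
  after changing the sign of \<open>b\<close>; then \<open>4u\<^sup>2 = 4 - 2(a|b) \<le> 4\<close>, so the even number \<open>u\<^sup>2\<close> vanishes.\<close>

section \<open>Coordinates and positive definiteness\<close>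

lemma del_pezzo_lattice_iff:
  "v \<in> del_pezzo_lattice n \<longleftrightarrow> (\<forall>i>n. v i = 0) \<and> (\<Sum>i=1..n. v i) = - 3 * v 0"
  by (auto simp: del_pezzo_lattice_def ambient_lattice_def lattice_form_canonical)

lemma roots_iff: "v \<in> roots n \<longleftrightarrow> v \<in> del_pezzo_lattice n \<and> lattice_form n v v = 2"
  by (simp add: roots_def)

lemma uminus_in_roots: "v \<in> roots n \<Longrightarrow> - v \<in> roots n"
  by (simp add: roots_iff del_pezzo_uminus lattice_form_def)

text \<open>Expanding the squares leaves a cross term in the sum of the \<open>v i\<close>, which
  orthogonality to K rewrites through \<open>v 0\<close>. The last coefficient is -K^2 = 9 - n,
  positive for n \<le> 8, so the identity certifies definiteness; it also bounds \<open>v 0\<close>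
  for a root.\<close>

lemma lattice_form_sum_squares:
  assumes "v \<in> del_pezzo_lattice n"
  shows "9 * lattice_form n v v = (\<Sum>i=1..n. (3 * v i + v 0)\<^sup>2) + (9 - int n) * (v 0)\<^sup>2"
proof -
  have "(\<Sum>i=1..n. (3 * v i + v 0)\<^sup>2)
      = (\<Sum>i=1..n. 9 * (v i * v i) + (6 * v 0) * v i + (v 0)\<^sup>2)"
    by (rule sum.cong) (simp_all add: power2_eq_square algebra_simps)
  also have "\<dots> = 9 * (\<Sum>i=1..n. v i * v i) + (6 * v 0) * (\<Sum>i=1..n. v i) + int n * (v 0)\<^sup>2"
    by (simp add: sum.distrib sum_distrib_left)
  also have "(\<Sum>i=1..n. v i) = - 3 * v 0"
    using assms by (simp add: del_pezzo_lattice_iff)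
  finally show ?thesis
    by (simp add: lattice_form_def power2_eq_square algebra_simps)
qed

lemma lattice_form_nonpos_imp_zero:
  assumes v: "v \<in> del_pezzo_lattice n" and "n \<le> 8" and "lattice_form n v v \<le> 0"
  shows "v = 0"
proof -
  let ?s = "\<Sum>i=1..n. (3 * v i + v 0)\<^sup>2"
  have s: "?s \<ge> 0"
    by (rule sum_nonneg) simp
  have "(v 0)\<^sup>2 \<le> (9 - int n) * (v 0)\<^sup>2"
    using \<open>n \<le> 8\<close> by (simp add: mult_le_cancel_right1)
  then have le: "?s + (v 0)\<^sup>2 \<le> 0"
    using lattice_form_sum_squares [OF v] assms(3) by linarith
  then have "(v 0)\<^sup>2 \<le> 0" using s by linarith
  then have v0: "v 0 = 0" by simp
  then have "?s = 0" using le s by simp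
  then have "v i = 0" if "i \<in> {1..n}" for i
    using that v0 by (simp add: sum_nonneg_eq_0_iff)
  moreover have "v i = 0" if "i > n" for i
    using v that by (simp add: del_pezzo_lattice_iff)
  ultimately show ?thesis
    using v0 by (metis One_nat_def Suc_leI atLeastAtMost_iff ext leI neq0_conv zero_fun_apply)
qed

section \<open>Classes modulo 2 and parities of coordinates\<close>

lemma reduction_eq_iff_parity:
  assumes v: "v \<in> del_pezzo_lattice n" and w: "w \<in> del_pezzo_lattice n"
  shows "reduction n v = reduction n w \<longleftrightarrow> (\<forall>i\<in>{1..n}. even (v i) \<longleftrightarrow> even (w i))"
proof
  assume "reduction n v = reduction n w"
  then have "v \<in> reduction n w"
    using reduction_self by blast
  then show "\<forall>i\<in>{1..n}. even (v i) \<longleftrightarrow> even (w i)"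
    by (auto simp: reduction_eq)
next
  assume par: "\<forall>i\<in>{1..n}. even (v i) \<longleftrightarrow> even (w i)"
  \<comment> \<open>Since 3 is odd, orthogonality to K makes the parity of coordinate 0 follow from
    those of the coordinates 1 to n.\<close>
  have sums: "(\<Sum>i=1..n. v i) - (\<Sum>i=1..n. w i) = - 3 * (v 0 - w 0)"
    using v w by (simp add: del_pezzo_lattice_iff)
  moreover have "even ((\<Sum>i=1..n. v i) - (\<Sum>i=1..n. w i))"
    unfolding sum_subtractf [symmetric] using par by (intro dvd_sum) simp
  ultimately have "even (v 0 - w 0)"
    by simp
  then have even: "even (v i - w i)" for i
    using par v w by (cases "i = 0"; cases "i \<le> n") (auto simp: del_pezzo_lattice_iff)
  define d where "d = (\<lambda>i. (v i - w i) div 2)"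
  have d: "2 * d i = v i - w i" for i
    using even by (simp add: d_def)
  \<comment> \<open>The linear condition cutting out L survives halving, so v - w lies in 2L and not
    merely in twice the ambient lattice.\<close>
  have "2 * (\<Sum>i=1..n. d i) = (\<Sum>i=1..n. v i) - (\<Sum>i=1..n. w i)"
    unfolding sum_distrib_left d sum_subtractf ..
  then have "(\<Sum>i=1..n. d i) = - 3 * d 0"
    using sums d [of 0] by presburger
  moreover have "d i = 0" if "i > n" for i
    using that v w by (simp add: d_def del_pezzo_lattice_iff)
  ultimately have dL: "d \<in> del_pezzo_lattice n"
    by (simp add: del_pezzo_lattice_iff)
  have vw: "v = w + (d + d)"
    using d by (auto simp: fun_eq_iff)
  \<comment> \<open>As v = w + 2d, shifting u by -d or by d turns a representative over w into one
    over v and back, which gives both inclusions of the cosets.\<close>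
  have "w + (u + u) = v + ((u - d) + (u - d))" "v + (u + u) = w + ((u + d) + (u + d))" for u
    by (simp_all add: vw algebra_simps)
  moreover have "u - d \<in> del_pezzo_lattice n" if "u \<in> del_pezzo_lattice n" for u
    using del_pezzo_add [OF that del_pezzo_uminus [OF dL]] by simp
  ultimately show "reduction n v = reduction n w"
    using del_pezzo_add dL unfolding reduction_eq by (auto simp only: image_iff)
qed

section \<open>Injectivity on antipodal classes\<close>

lemma reduction_uminus:
  "v \<in> del_pezzo_lattice n \<Longrightarrow> reduction n (- v) = reduction n v"
  by (simp add: reduction_eq_iff_parity del_pezzo_uminus)

lemma reduction_eq_nonneg_imp_eq:
  assumes "n \<le> 8" and a: "a \<in> roots n" and b: "b \<in> roots n"
    and red: "reduction n a = reduction n b" and nonneg: "lattice_form n a b \<ge> 0"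
  shows "a = b"
proof -
  have "a \<in> reduction n b"
    using red reduction_self by blast
  then obtain u where u: "u \<in> del_pezzo_lattice n" "a = b + (u + u)"
    by (auto simp: reduction_eq)
  have "lattice_form n a b = 2 + 2 * lattice_form n u b"
    using b by (simp only: u(2) lattice_form_add_left roots_iff)
  moreover have "lattice_form n a a = 2 + 4 * lattice_form n u b + 4 * lattice_form n u u"
    using b by (simp only: u(2) lattice_form_add_left lattice_form_add_right roots_iff
        lattice_form_commute [of n b u])
  moreover have "lattice_form n a a = 2"
    using a by (simp add: roots_iff)
  \<comment> \<open>The second and third identities give (u|b) = -u^2, and the first then reads
    (a|b) = 2 - 2u^2.\<close>
  ultimately have "lattice_form n u u \<le> 1"
    using nonneg by linarith
  then have "lattice_form n u u \<le> 0"
    using even_lattice_form [OF u(1)] by presburger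
  then have "u = 0"
    using lattice_form_nonpos_imp_zero u(1) \<open>n \<le> 8\<close> by blast
  then show ?thesis
    using u(2) by simp
qed

lemma reduction_eq_imp_antipodal:
  assumes "n \<le> 8" and a: "a \<in> roots n" and b: "b \<in> roots n"
    and red: "reduction n a = reduction n b"
  shows "b = a \<or> b = - a"
proof (cases "lattice_form n a b \<ge> 0")
  case True
  then show ?thesis
    using reduction_eq_nonneg_imp_eq assms by blast
next
  case False
  then have "lattice_form n a (- b) \<ge> 0"
    by (simp add: lattice_form_commute [of n a] lattice_form_uminus_left)
  moreover have "reduction n a = reduction n (- b)"
    using red b by (simp add: reduction_uminus roots_iff)
  ultimately have "a = - b"
    using reduction_eq_nonneg_imp_eq assms(1) a uminus_in_roots [OF b] by blast
  then show ?thesis by simp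
qed

lemma respects_antipodal: "reduction n respects antipodal n"
  by (auto simp: congruent_def antipodal_def reduction_uminus roots_iff)

lemma induced_reduction_class:
  assumes "a \<in> roots n"
  shows "induced_reduction n (antipodal n `` {a}) = reduction n a"
  unfolding induced_reduction_def
proof (rule the_elem_image_const)
  show "a \<in> antipodal n `` {a}"
    using assms by (simp add: antipodal_def)
qed (auto simp: antipodal_def reduction_uminus roots_iff)

text \<open>Settles injectivity for all n \<le> 8 at once; what remains is to determine which
  classes are reductions of roots.\<close>

lemma bij_betw_induced_reduction:
  assumes "n \<le> 8"
  shows "bij_betw (induced_reduction n) (roots n // antipodal n) (reduction n ` roots n)"
proof (rule bij_betw_imageI)
  show "inj_on (induced_reduction n) (roots n // antipodal n)"
  proof (rule inj_onI)
    fix A B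
    assume "A \<in> roots n // antipodal n" "B \<in> roots n // antipodal n"
      and eq: "induced_reduction n A = induced_reduction n B"
    then obtain a b where ab: "a \<in> roots n" "b \<in> roots n"
      and AB: "A = antipodal n `` {a}" "B = antipodal n `` {b}"
      by (auto elim!: quotientE)
    then have "reduction n a = reduction n b"
      using eq by (simp only: induced_reduction_class)
    then have "(a, b) \<in> antipodal n"
      using reduction_eq_imp_antipodal [OF assms ab] ab by (simp add: antipodal_def)
    then show "A = B"
      unfolding AB by (rule equiv_class_eq [OF equiv_antipodal])
  qed
  show "induced_reduction n ` (roots n // antipodal n) = reduction n ` roots n"
    by (auto simp: quotient_def induced_reduction_class image_iff)
qed

section \<open>Odd coordinates of the classes with q = 1\<close>

lemma quad_mod2_reduction_eq_1_iff:
  assumes "v \<in> del_pezzo_lattice n"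
  shows "quad_mod2 n (reduction n v) = 1 \<longleftrightarrow> lattice_form n v v mod 4 = 2"
proof -
  have bit: "(of_int x :: bit) = 1 \<longleftrightarrow> odd x" for x
    by (cases "even x") (auto elim!: evenE oddE)
  show ?thesis
    using even_lattice_form [OF assms] by (simp add: quad_mod2_reduction assms bit) presburger
qed

lemma reduction_roots_subset: "reduction n ` roots n \<subseteq> quad_one n"
  by (auto simp: quad_one_def carrier_lattice_mod2 quad_mod2_reduction_eq_1_iff roots_iff)

lemma square_mod_4: "(4 :: int) dvd x * x - of_bool (odd x)"
proof (cases "even x")
  case False
  then obtain y where "x = 2 * y + 1" by (auto elim: oddE)
  then have "x * x - 1 = 4 * (y * y + y)" by (simp add: algebra_simps)
  with False show ?thesis by simp
qed (auto elim!: evenE)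

text \<open>Modulo 4 the form is the number of odd coordinates among 1 to n, minus 0 or 1 according
  to the parity of \<open>v 0\<close>.\<close>

lemma card_odd_coordinates:
  assumes "lattice_form n v v mod 4 = 2"
  shows "card {i \<in> {1..n}. odd (v i)} mod 4 \<in> {2, 3}"
proof -
  let ?S = "{i \<in> {1..n}. odd (v i)}"
  have "4 dvd (\<Sum>i=1..n. v i * v i - of_bool (odd (v i)))"
    by (intro dvd_sum square_mod_4)
  moreover have "(\<Sum>i=1..n. of_bool (odd (v i)) :: int) = int (card ?S)"
    by (simp add: of_bool_def sum.If_cases Int_def)
  ultimately have "4 dvd (\<Sum>i=1..n. v i * v i) - int (card ?S)"
    by (simp add: sum_subtractf)
  moreover have "4 dvd v 0 * v 0 \<or> 4 dvd v 0 * v 0 - 1"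
    using square_mod_4 [of "v 0"] by (cases "even (v 0)") auto
  ultimately have "int (card ?S) mod 4 \<in> {2, 3}"
    using assms unfolding lattice_form_def by (simp add: algebra_simps) presburger
  then show ?thesis
    by simp presburger
qed

section \<open>Roots with a prescribed set of odd coordinates\<close>

lemma sum_two_valued:
  fixes c d :: int
  assumes "S \<subseteq> {1..n}"
  shows "(\<Sum>i=1..n. if i \<in> S then c else d) = int (card S) * c + (int n - int (card S)) * d"
proof -
  have "card S \<le> n"
    using card_mono [OF _ assms] by simp
  moreover have "{1..n} \<inter> S = S" "card ({1..n} - S) = n - card S"
    using assms by (auto simp: card_Diff_subset finite_subset)
  ultimately show ?thesis
    by (simp add: sum.If_cases Diff_eq [symmetric] of_nat_diff)
qed

text \<open>The roots used for |S| = 3, 6, 7 are constant on S and on its complement in {1..n}, with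
  \<open>m\<close> as coefficient of E_0.\<close>

definition two_valued_vec :: "nat \<Rightarrow> nat set \<Rightarrow> int \<Rightarrow> int \<Rightarrow> int \<Rightarrow> nat \<Rightarrow> int" where
  "two_valued_vec n S m c d = (\<lambda>i. if i = 0 then m else if i > n then 0 else if i \<in> S then c else d)"

text \<open>\<open>sum\<close> expresses orthogonality to K and \<open>square\<close> expresses
  square 2, so each such root comes down to two integer identities.\<close>

lemma two_valued_vec_in_roots:
  assumes S: "S \<subseteq> {1..n}"
    and sum: "int (card S) * c + (int n - int (card S)) * d = - 3 * m"
    and square: "int (card S) * (c * c) + (int n - int (card S)) * (d * d) = m * m + 2"
  shows "two_valued_vec n S m c d \<in> roots n"
proof -
  let ?v = "two_valued_vec n S m c d"
  have "(\<Sum>i=1..n. ?v i) = (\<Sum>i=1..n. if i \<in> S then c else d)"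
    "(\<Sum>i=1..n. ?v i * ?v i) = (\<Sum>i=1..n. if i \<in> S then c * c else d * d)"
    by (rule sum.cong; simp add: two_valued_vec_def)+
  then show ?thesis
    using sum square unfolding sum_two_valued [OF S]
    by (simp add: roots_iff del_pezzo_lattice_iff lattice_form_def) (simp add: two_valued_vec_def)
qed

text \<open>The differences E_i - E_j serve twice: as the roots for |S| = 2, and as test vectors for
  the kernel of the bilinear form.\<close>

lemma lattice_form_basis_vec_diff:
  assumes "i \<in> {1..n}" "j \<in> {1..n}"
  shows "lattice_form n v (basis_vec i - basis_vec j) = v i - v j"
proof -
  have "lattice_form n v (basis_vec i - basis_vec j)
      = (\<Sum>l=1..n. (if l = i then v l else 0) - (if l = j then v l else 0))"
    using assms by (auto simp: lattice_form_def basis_vec_def intro!: sum.cong)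
  then show ?thesis
    using assms by (simp add: sum_subtractf)
qed

lemma basis_vec_diff_in_del_pezzo_lattice:
  assumes "i \<in> {1..n}" "j \<in> {1..n}"
  shows "basis_vec i - basis_vec j \<in> del_pezzo_lattice n"
proof -
  have "canonical_vec n i = canonical_vec n j"
    using assms by (simp add: canonical_vec_def basis_vec_def)
  then have "lattice_form n (basis_vec i - basis_vec j) (canonical_vec n) = 0"
    using assms by (simp add: lattice_form_commute lattice_form_basis_vec_diff)
  then show ?thesis
    using assms by (simp add: del_pezzo_lattice_def ambient_lattice_def basis_vec_def)
qed

lemma root_with_odd_set:
  assumes "n \<le> 8" and S: "S \<subseteq> {1..n}" and card: "card S mod 4 \<in> {2, 3}"
    and "n = 7 \<Longrightarrow> S \<noteq> {1..n}"
  shows "\<exists>r\<in>roots n. \<forall>i\<in>{1..n}. odd (r i) \<longleftrightarrow> i \<in> S"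
proof -
  have le: "card S \<le> n"
    using card_mono [OF _ S] by simp
  \<comment> \<open>A set of seven indices is the full set when n = 7, which is excluded; hence |S|
    = 7 leaves only n = 8.\<close>
  have "card S \<noteq> 7" if "n = 7"
    using assms(4) [OF that] S that card_subset_eq [of "{1..n}" S] by auto
  then have "card S = 2 \<or> card S = 3 \<or> card S = 6 \<or> card S = 7 \<and> n = 8"
    using card le \<open>n \<le> 8\<close> by simp presburger
  then consider "card S = 2" | "card S = 3" | "card S = 6" | "card S = 7" "n = 8"
    by blast
  then show ?thesis
  proof cases
    case 1
    then obtain i j where ij: "S = {i, j}" "i \<noteq> j"
      by (auto simp: card_2_iff)
    with S have mem: "i \<in> {1..n}" "j \<in> {1..n}" by auto
    have "basis_vec i - basis_vec j \<in> roots n"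
      using ij(2) by (simp add: roots_iff basis_vec_diff_in_del_pezzo_lattice [OF mem]
          lattice_form_basis_vec_diff [OF mem]) (simp add: basis_vec_def)
    then show ?thesis
      using ij by (intro bexI) (auto simp: basis_vec_def)
  next
    case 2
    then have "two_valued_vec n S 1 (- 1) 0 \<in> roots n"
      by (intro two_valued_vec_in_roots [OF S]) simp_all
    then show ?thesis
      by (rule bexI [rotated]) (auto simp: two_valued_vec_def)
  next
    case 3
    then have "two_valued_vec n S 2 (- 1) 0 \<in> roots n"
      by (intro two_valued_vec_in_roots [OF S]) simp_all
    then show ?thesis
      by (rule bexI [rotated]) (auto simp: two_valued_vec_def)
  next
    case 4
    \<comment> \<open>The single index outside S carries the even value -2: -7 - 2 = -3 * 3 and 7 +
      4 = 3 * 3 + 2.\<close>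
    then have "two_valued_vec n S 3 (- 1) (- 2) \<in> roots n"
      by (intro two_valued_vec_in_roots [OF S]) simp_all
    then show ?thesis
      by (rule bexI [rotated]) (auto simp: two_valued_vec_def)
  qed
qed

lemma quad_one_in_reduction_roots:
  assumes "n \<le> 8" and v: "v \<in> del_pezzo_lattice n" and quad: "reduction n v \<in> quad_one n"
    and "n = 7 \<Longrightarrow> \<exists>i\<in>{1..n}. even (v i)"
  shows "reduction n v \<in> reduction n ` roots n"
proof -
  let ?S = "{i \<in> {1..n}. odd (v i)}"
  have "lattice_form n v v mod 4 = 2"
    using quad v by (simp add: quad_one_def quad_mod2_reduction_eq_1_iff)
  then have "card ?S mod 4 \<in> {2, 3}"
    by (rule card_odd_coordinates)
  moreover have "?S \<noteq> {1..n}" if "n = 7"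
    using assms(4) [OF that] by blast
  ultimately obtain r where r: "r \<in> roots n" "\<forall>i\<in>{1..n}. odd (r i) \<longleftrightarrow> i \<in> ?S"
    using root_with_odd_set [of n ?S] \<open>n \<le> 8\<close> by blast
  then have "reduction n v = reduction n r"
    using v by (subst reduction_eq_iff_parity) (auto simp: roots_iff)
  then show ?thesis
    using r(1) by blast
qed

section \<open>The kernel of the bilinear form\<close>

lemma reduction_in_bilin_kernel_iff:
  assumes "v \<in> del_pezzo_lattice n"
  shows "reduction n v \<in> bilin_kernel n
    \<longleftrightarrow> (\<forall>w\<in>del_pezzo_lattice n. even (lattice_form n v w))"
proof -
  have "(of_int x :: bit) = 0 \<longleftrightarrow> even x" for x
    by (cases "even x") (auto elim!: evenE oddE)
  then show ?thesis
    using assms by (simp add: bilin_kernel_def carrier_lattice_mod2 bilin_mod2_reduction)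
qed

text \<open>Pairing with E_i - E_j compares two coordinates, so a kernel class is either zero or the
  class with all coordinates from 1 to n odd.\<close>

lemma bilin_kernel_imp_parity:
  assumes v: "v \<in> del_pezzo_lattice n" and "reduction n v \<in> bilin_kernel n"
    and ij: "i \<in> {1..n}" "j \<in> {1..n}"
  shows "even (v i) \<longleftrightarrow> even (v j)"
proof -
  have "even (lattice_form n v (basis_vec i - basis_vec j))"
    using assms by (simp add: reduction_in_bilin_kernel_iff basis_vec_diff_in_del_pezzo_lattice)
  then show ?thesis
    using ij by (simp add: lattice_form_basis_vec_diff)
qed

text \<open>Modulo 2 the sum of the \<open>v i * w i\<close> is the sum of the \<open>w i\<close>,
  which is congruent to \<open>w 0\<close>. As n is odd, \<open>v 0\<close> is odd too, so the term
  \<open>v 0 * w 0\<close> cancels it.\<close>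

lemma all_odd_imp_bilin_kernel:
  assumes v: "v \<in> del_pezzo_lattice n" and "odd n" and odd: "\<forall>i\<in>{1..n}. odd (v i)"
  shows "reduction n v \<in> bilin_kernel n"
  unfolding reduction_in_bilin_kernel_iff [OF v]
proof
  fix w assume w: "w \<in> del_pezzo_lattice n"
  have "even (\<Sum>i=1..n. (v i - 1) * w i)"
    using odd by (intro dvd_sum) simp
  moreover have "(\<Sum>i=1..n. (v i - 1) * w i) = (\<Sum>i=1..n. v i * w i) + 3 * w 0"
    using w by (simp add: algebra_simps sum_subtractf del_pezzo_lattice_iff)
  moreover have "odd (v 0)"
  proof -
    have "even (\<Sum>i=1..n. v i - 1)"
      using odd by (intro dvd_sum) simp
    then show ?thesis
      using v \<open>odd n\<close> by (simp add: sum_subtractf del_pezzo_lattice_iff)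
  qed
  ultimately show "even (lattice_form n v w)"
    by (auto simp: lattice_form_def)
qed

lemma one_lattice_mod2: "\<one>\<^bsub>lattice_mod2 n\<^esub> = reduction n 0"
  by (auto simp: lattice_mod2_def FactGroup_def reduction_eq double_lattice_def)

lemma reduction_eq_one_iff:
  "v \<in> del_pezzo_lattice n \<Longrightarrow> reduction n v = \<one>\<^bsub>lattice_mod2 n\<^esub> \<longleftrightarrow> (\<forall>i\<in>{1..n}. even (v i))"
  by (simp add: one_lattice_mod2 reduction_eq_iff_parity del_pezzo_zero)

section \<open>The exceptional class for n = 7\<close>

lemma nonzero_bilin_kernel_7_iff:
  assumes v: "v \<in> del_pezzo_lattice 7"
  shows "reduction 7 v \<in> bilin_kernel 7 \<and> reduction 7 v \<noteq> \<one>\<^bsub>lattice_mod2 7\<^esub>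
    \<longleftrightarrow> (\<forall>i\<in>{1..7}. odd (v i))"
proof
  assume "reduction 7 v \<in> bilin_kernel 7 \<and> reduction 7 v \<noteq> \<one>\<^bsub>lattice_mod2 7\<^esub>"
  then show "\<forall>i\<in>{1..7}. odd (v i)"
    using bilin_kernel_imp_parity [OF v] reduction_eq_one_iff [OF v] by blast
next
  assume odd: "\<forall>i\<in>{1..7}. odd (v i)"
  then have "odd (v 1)" by simp
  then show "reduction 7 v \<in> bilin_kernel 7 \<and> reduction 7 v \<noteq> \<one>\<^bsub>lattice_mod2 7\<^esub>"
    using all_odd_imp_bilin_kernel [OF v] odd reduction_eq_one_iff [OF v] by force
qed

lemma ex_all_odd_del_pezzo_7: "\<exists>v\<in>del_pezzo_lattice 7. \<forall>i\<in>{1..7}. odd (v i)"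
proof
  \<comment> \<open>A vector with equal coordinates c at 1 to 7 and m at 0 lies in L when 7c = -3m;
    this is the smallest nonzero solution up to sign, and c is odd. Its square is 63 - 49 = 14, so
    q(k) = 1 and k really has to be removed.\<close>
  let ?v = "(\<lambda>i. if i = 0 then 7 else if i \<le> 7 then - 3 else 0) :: nat \<Rightarrow> int"
  show "?v \<in> del_pezzo_lattice 7"
    by (simp add: del_pezzo_lattice_iff)
qed auto

text \<open>Shows that k is not the reduction of a root: for an all-odd root, the square of
  \<open>v 0\<close> is squeezed between 5 and 9, and the remaining value 9 makes every square in
  \<open>lattice_form_sum_squares\<close> vanish.\<close>

lemma root_7_has_even_coordinate:
  assumes "v \<in> roots 7"
  shows "\<exists>i\<in>{1..7}. even (v i)"
proof (rule ccontr)
  assume "\<not> ?thesis"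
  then have odd: "odd (v i)" if "i \<in> {1..7}" for i
    using that by blast
  have v: "v \<in> del_pezzo_lattice 7" "lattice_form 7 v v = 2"
    using assms by (auto simp: roots_iff)
  have sum: "(\<Sum>i=1..7. v i) = - 3 * v 0"
    using v by (simp add: del_pezzo_lattice_iff)
  have "1 \<le> v i * v i" if "i \<in> {1..7}" for i
    using odd [OF that] zero_less_power2 [of "v i"] by (cases "v i = 0") (simp_all add: power2_eq_square)
  then have "(\<Sum>i=1..7::nat. 1) \<le> (\<Sum>i=1..7. v i * v i)"
    by (intro sum_mono) simp
  \<comment> \<open>Seven odd coordinates contribute at least 7 to a vector of square 2.\<close>
  then have ge: "(v 0)\<^sup>2 \<ge> 5"
    using v(2) by (simp add: lattice_form_def power2_eq_square)
  let ?s = "\<Sum>i=1..7. (3 * v i + v 0)\<^sup>2"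
  have s: "?s \<ge> 0"
    by (rule sum_nonneg) simp
  have eq: "18 = ?s + 2 * (v 0)\<^sup>2"
    using lattice_form_sum_squares [OF v(1)] v(2) by simp
  have "(v 0)\<^sup>2 \<le> 3\<^sup>2"
    using eq s by simp
  then have "\<bar>v 0\<bar> \<le> 3"
    using power2_le_iff_abs_le [of 3 "v 0"] by linarith
  moreover have "\<not> \<bar>v 0\<bar> \<le> 2"
    using power2_le_iff_abs_le [of 2 "v 0"] ge by simp
  ultimately have abs: "\<bar>v 0\<bar> = 3" by linarith
  then have "v 0 = 3 \<or> v 0 = - 3" by linarith
  then have "(v 0)\<^sup>2 = 9" by (elim disjE) simp_all
  then have "?s = 0" using eq by simp
  then have "3 * v i + v 0 = 0" if "i \<in> {1..7}" for i
    using that by (simp add: sum_nonneg_eq_0_iff)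
  then have "(\<Sum>i=1..7. 3 * v i + v 0) = 0"
    by (intro sum.neutral) blast
  \<comment> \<open>Summing the seven equations and inserting orthogonality to K gives -2 *
    \<open>v 0\<close> = 0, against |\<open>v 0\<close>| = 3.\<close>
  then have "3 * (- 3 * v 0) + 7 * v 0 = 0"
    by (simp add: sum.distrib sum_distrib_left [symmetric] sum del: One_nat_def)
  then show False using abs by simp
qed

theorem proposition1:
  fixes n :: nat
  assumes "3 \<le> n" and "n \<le> 8"
  shows "reduction n respects antipodal n
    \<and> (n \<noteq> 7 \<longrightarrow>
         bij_betw (induced_reduction n) (roots n // antipodal n) (quad_one n))
    \<and> (n = 7 \<longrightarrow>
         (\<exists>!k. k \<in> bilin_kernel n \<and> k \<noteq> \<one>\<^bsub>lattice_mod2 n\<^esub>)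
         \<and> (\<forall>k. k \<in> bilin_kernel n \<and> k \<noteq> \<one>\<^bsub>lattice_mod2 n\<^esub> \<longrightarrow>
              bij_betw (induced_reduction n) (roots n // antipodal n) (quad_one n - {k})))"
proof (intro conjI impI)
  show "reduction n respects antipodal n"
    by (rule respects_antipodal)
next
  assume "n \<noteq> 7"
  then have "quad_one n \<subseteq> reduction n ` roots n"
    using quad_one_in_reduction_roots [OF \<open>n \<le> 8\<close>]
    by (auto simp: quad_one_def carrier_lattice_mod2)
  then show "bij_betw (induced_reduction n) (roots n // antipodal n) (quad_one n)"
    using bij_betw_induced_reduction [OF \<open>n \<le> 8\<close>] reduction_roots_subset [of n] by auto
next
  assume n: "n = 7"
  obtain e where e: "e \<in> del_pezzo_lattice 7" "\<forall>i\<in>{1..7}. odd (e i)"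
    using ex_all_odd_del_pezzo_7 by blast
  \<comment> \<open>All-odd vectors share one class, that of \<open>e\<close>; existence, uniqueness
    and the quantification over k all reduce to this explicit class.\<close>
  have kernel: "k \<in> bilin_kernel n \<and> k \<noteq> \<one>\<^bsub>lattice_mod2 n\<^esub> \<longleftrightarrow> k = reduction 7 e" for k
  proof
    assume k: "k \<in> bilin_kernel n \<and> k \<noteq> \<one>\<^bsub>lattice_mod2 n\<^esub>"
    then obtain v where v: "v \<in> del_pezzo_lattice 7" "k = reduction 7 v"
      by (auto simp: bilin_kernel_def carrier_lattice_mod2 n)
    then show "k = reduction 7 e"
      using k e nonzero_bilin_kernel_7_iff [OF v(1)] by (simp add: reduction_eq_iff_parity n)
  qed (use nonzero_bilin_kernel_7_iff [OF e(1)] e(2) n in auto)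
  show "\<exists>!k. k \<in> bilin_kernel n \<and> k \<noteq> \<one>\<^bsub>lattice_mod2 n\<^esub>"
    unfolding kernel by simp
  have all_odd: "reduction 7 v = reduction 7 e \<longleftrightarrow> (\<forall>i\<in>{1..7}. odd (v i))"
    if "v \<in> del_pezzo_lattice 7" for v
    using that e by (simp add: reduction_eq_iff_parity)
  have "reduction 7 ` roots 7 = quad_one 7 - {reduction 7 e}"
  proof
    show "reduction 7 ` roots 7 \<subseteq> quad_one 7 - {reduction 7 e}"
      using reduction_roots_subset [of 7] root_7_has_even_coordinate all_odd
      by (fastforce simp: roots_iff)
    show "quad_one 7 - {reduction 7 e} \<subseteq> reduction 7 ` roots 7"
    proof
      fix X assume X: "X \<in> quad_one 7 - {reduction 7 e}"
      then obtain v where v: "v \<in> del_pezzo_lattice 7" "X = reduction 7 v"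
        by (auto simp: quad_one_def carrier_lattice_mod2)
      then show "X \<in> reduction 7 ` roots 7"
        using X all_odd [OF v(1)] quad_one_in_reduction_roots [of 7 v] by simp
    qed
  qed
  then show "\<forall>k. k \<in> bilin_kernel n \<and> k \<noteq> \<one>\<^bsub>lattice_mod2 n\<^esub> \<longrightarrow>
      bij_betw (induced_reduction n) (roots n // antipodal n) (quad_one n - {k})"
    unfolding kernel using bij_betw_induced_reduction [OF \<open>n \<le> 8\<close>] by (simp add: n)
qed

end
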